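(* Let $p\ge5$ be an odd prime. The image of the genus one $\mathrm{SO}(p)_2$-TQFT representation $\rho_1:\mathrm{SL}(2,\mathbb{Z})\to\mathrm{PGL}(H)$ is finite.
   Context: Let $r=\frac{p-1}{2}$, $\zeta=e^{2\pi i/p}$, $\psi=e^{2\pi i r/8}$, and $\theta_j=\zeta^{rj^2}$ for $j\in\mathbb{Z}$. Let $H$ be the complex vector space of dimension $r+4$ with fixed basis $\mathbf{1},\mathbf{Z},\mathbf{Y}_1,\dots,\mathbf{Y}_r,\mathbf{X},\mathbf{X}'$ (the simple objects of the modular category $\mathrm{SO}(p)_2$). Let $\sigma=\begin{bmatrix}0&-1\\1&0\end{bmatrix}$, $\tau=\begin{bmatrix}1&1\\0&1\end{bmatrix}$ be generators of $\mathrm{SL}(2,\mathbb{Z})$. The genus one representation of the $\mathrm{SO}(p)_2$-TQFT is the projective representation $\rho_1:\mathrm{SL}(2,\mathbb{Z})\to\mathrm{PGL}(H)$ given on generators by the classes of the linear maps $\rho_1(\sigma)\mathbf{1}=\frac{1}{2\sqrt p}(\mathbf{1}+\mathbf{Z})+\frac{1}{\sqrt p}\sum_{k=1}^r\mathbf{Y}_k+\frac12(\mathbf{X}+\mathbf{X}')$, $\rho_1(\sigma)\mathbf{Z}=\frac{1}{2\sqrt p}(\mathbf{1}+\mathbf{Z})+\frac{1}{\sqrt p}\sum_{k=1}^r\mathbf{Y}_k-\frac12(\mathbf{X}+\mathbf{X}')$, $\rho_1(\sigma)\mathbf{Y}_j=\frac{1}{\sqrt p}(\mathbf{1}+\mathbf{Z})+\sum_{k=1}^r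 A_{kj}\mathbf{Y}_k$ with $A_{jk}=\frac{1}{\sqrt p}(\zeta^{jk}+\zeta^{-jk})$, $\rho_1(\sigma)\mathbf{X}=\frac12(\mathbf{1}-\mathbf{Z})+\frac12(\mathbf{X}-\mathbf{X}')$, $\rho_1(\sigma)\mathbf{X}'=\frac12(\mathbf{1}-\mathbf{Z})-\frac12(\mathbf{X}-\mathbf{X}')$; and $\rho_1(\tau)$ diagonal with $\mathbf{1}\mapsto\mathbf{1}$, $\mathbf{Z}\mapsto\mathbf{Z}$, $\mathbf{Y}_j\mapsto\theta_j\mathbf{Y}_j$, $\mathbf{X}\mapsto\psi\mathbf{X}$, $\mathbf{X}'\mapsto-\psi\mathbf{X}'$. *)

theory Defs
  imports
    Complex_Main
    "HOL-Algebra.Coset"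
    "HOL-Algebra.Divisibility"
    "HOL-Computational_Algebra.Primes"
    "Jordan_Normal_Form.Matrix"
    "Jordan_Normal_Form.Determinant"
begin

definition SL2Z :: "int mat monoid" where
  "SL2Z = \<lparr>carrier = {M \<in> carrier_mat 2 2. det M = 1}, mult = (*), one = 1\<^sub>m 2\<rparr>"

definition sigma :: "int mat" where
  "sigma = mat_of_rows_list 2 [[0, -1], [1, 0]]"

definition tau :: "int mat" where
  "tau = mat_of_rows_list 2 [[1, 1], [0, 1]]"

definition GL :: "nat \<Rightarrow> complex mat monoid" where
  "GL n = units_of (ring_mat TYPE(complex) n ())"

definition scalars :: "nat \<Rightarrow> complex mat set" where
  "scalars n = {c \<cdot>\<^sub>m 1\<^sub>m n | c. c \<noteq> 0}"

definition PGL :: "nat \<Rightarrow> complex mat set monoid" where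
  "PGL n = GL n Mod scalars n"

definition proj_class :: "nat \<Rightarrow> complex mat \<Rightarrow> complex mat set" where
  "proj_class n M = scalars n #>\<^bsub>GL n\<^esub> M"

definition half :: "nat \<Rightarrow> nat" where
  "half p = (p - 1) div 2"

definition zeta :: "nat \<Rightarrow> complex" where
  "zeta p = exp (2 * of_real pi * \<i> / of_nat p)"

definition psi :: "nat \<Rightarrow> complex" where
  "psi p = exp (2 * of_real pi * \<i> * of_nat (half p) / 8)"

definition theta :: "nat \<Rightarrow> int \<Rightarrow> complex" where
  "theta p j = zeta p powi (int (half p) * j ^ 2)"

text \<open>
  The space with basis \<open>1, Z, Y\<^sub>1, \<dots>, Y\<^sub>r, X, X'\<close> (where \<open>r = (p - 1) / 2\<close>) is the space of
  column vectors of length \<open>r + 4\<close>, the basis being the unit vectors in this order.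
  So \<open>Y\<^sub>j\<close> sits at (0-based) position \<open>j + 1\<close>.
\<close>

definition dimH :: "nat \<Rightarrow> nat" where
  "dimH p = half p + 4"

definition b_one :: "nat \<Rightarrow> complex vec" where
  "b_one p = unit_vec (dimH p) 0"

definition b_Z :: "nat \<Rightarrow> complex vec" where
  "b_Z p = unit_vec (dimH p) 1"

definition b_Y :: "nat \<Rightarrow> nat \<Rightarrow> complex vec" where
  "b_Y p j = unit_vec (dimH p) (j + 1)"

definition b_X :: "nat \<Rightarrow> complex vec" where
  "b_X p = unit_vec (dimH p) (half p + 2)"

definition b_X' :: "nat \<Rightarrow> complex vec" where
  "b_X' p = unit_vec (dimH p) (half p + 3)"

definition rsqrt :: "nat \<Rightarrow> complex" where
  "rsqrt p = 1 / of_real (sqrt (real p))"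

definition coeffA :: "nat \<Rightarrow> nat \<Rightarrow> nat \<Rightarrow> complex" where
  "coeffA p j k = rsqrt p * (zeta p powi (int j * int k) + zeta p powi (- (int j * int k)))"

definition sum_Y :: "nat \<Rightarrow> (nat \<Rightarrow> complex) \<Rightarrow> complex vec" where
  "sum_Y p c = finsum_vec TYPE(complex) (dimH p) (\<lambda>k. c k \<cdot>\<^sub>v b_Y p k) {1..half p}"

text \<open>
  The linear maps representing the images of \<open>sigma\<close> and \<open>tau\<close>: the columns are the images of
  the basis vectors, in the order fixed above.
\<close>

definition rho_sigma :: "nat \<Rightarrow> complex mat" where
  "rho_sigma p = mat_of_cols (dimH p)
    ([(rsqrt p / 2) \<cdot>\<^sub>v (b_one p + b_Z p) + rsqrt p \<cdot>\<^sub>v sum_Y p (\<lambda>k. 1)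
        + (1 / 2) \<cdot>\<^sub>v (b_X p + b_X' p),
      (rsqrt p / 2) \<cdot>\<^sub>v (b_one p + b_Z p) + rsqrt p \<cdot>\<^sub>v sum_Y p (\<lambda>k. 1)
        - (1 / 2) \<cdot>\<^sub>v (b_X p + b_X' p)]
     @ map (\<lambda>j. rsqrt p \<cdot>\<^sub>v (b_one p + b_Z p) + sum_Y p (\<lambda>k. coeffA p k j)) [1..<half p + 1]
     @ [(1 / 2) \<cdot>\<^sub>v (b_one p - b_Z p) + (1 / 2) \<cdot>\<^sub>v (b_X p - b_X' p),
        (1 / 2) \<cdot>\<^sub>v (b_one p - b_Z p) - (1 / 2) \<cdot>\<^sub>v (b_X p - b_X' p)])"

definition rho_tau :: "nat \<Rightarrow> complex mat" where
  "rho_tau p = mat_of_cols (dimH p)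
    ([b_one p, b_Z p]
     @ map (\<lambda>j. theta p (int j) \<cdot>\<^sub>v b_Y p j) [1..<half p + 1]
     @ [psi p \<cdot>\<^sub>v b_X p, (- psi p) \<cdot>\<^sub>v b_X' p])"

lemma group_SL2Z: "group SL2Z"
proof (rule groupI)
  fix M assume "M \<in> carrier SL2Z"
  then have M: "M \<in> carrier_mat 2 2" "det M = 1" by (auto simp: SL2Z_def)
  note adj = adj_mat[OF M(1)]
  have eq: "adj_mat M * M = 1\<^sub>m 2" using adj(3) M by (auto intro!: eq_matI)
  have "det (adj_mat M) = 1" using det_mult[OF adj(1) M(1)] eq M(2) by simp
  then show "\<exists>N\<in>carrier SL2Z. N \<otimes>\<^bsub>SL2Z\<^esub> M = \<one>\<^bsub>SL2Z\<^esub>"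
    using adj(1) eq by (auto simp: SL2Z_def)
qed (auto simp: SL2Z_def det_mult)

lemma sigma_in_SL2Z: "sigma \<in> carrier SL2Z"
  unfolding SL2Z_def sigma_def mat_of_rows_list_def
  by (auto simp: laplace_expansion_row[of _ 2 0] cofactor_def mat_delete_def numeral_2_eq_2 det_single)

lemma tau_in_SL2Z: "tau \<in> carrier SL2Z"
  unfolding SL2Z_def tau_def mat_of_rows_list_def
  by (auto simp: laplace_expansion_row[of _ 2 0] cofactor_def mat_delete_def numeral_2_eq_2 det_single)

lemma monoid_ring_mat: "monoid (ring_mat TYPE(complex) n ())"
  by (rule monoidI) (auto simp: ring_mat_def)

lemma group_GL: "group (GL n)"
  unfolding GL_def by (rule monoid.units_group[OF monoid_ring_mat])

lemma scalars_normal: "scalars n \<lhd> GL n"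
proof -
  interpret group "GL n" by (rule group_GL)
  have mult: "x \<otimes>\<^bsub>GL n\<^esub> y = x * y" for x y
    by (simp add: GL_def units_of_def ring_mat_def)
  have one: "\<one>\<^bsub>GL n\<^esub> = 1\<^sub>m n"
    by (simp add: GL_def units_of_def ring_mat_def)
  have car: "carrier (GL n) \<subseteq> carrier_mat n n"
    by (auto simp: GL_def units_of_def Units_def ring_mat_def)
  have prod: "(c \<cdot>\<^sub>m 1\<^sub>m n) * (d \<cdot>\<^sub>m 1\<^sub>m n) = (c * d) \<cdot>\<^sub>m (1\<^sub>m n :: complex mat)" for c d
    by (auto simp: mult.commute)
  have sub: "scalars n \<subseteq> carrier (GL n)"
  proof
    fix x assume "x \<in> scalars n"
    then obtain c where c: "x = c \<cdot>\<^sub>m 1\<^sub>m n" "c \<noteq> 0" by (auto simp: scalars_def)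
    have "\<exists>y\<in>carrier_mat n n. y * x = 1\<^sub>m n \<and> x * y = 1\<^sub>m n"
      using c by (intro bexI[of _ "(1 / c) \<cdot>\<^sub>m 1\<^sub>m n"]) (auto simp: prod)
    then show "x \<in> carrier (GL n)"
      using c by (auto simp: GL_def units_of_def Units_def ring_mat_def)
  qed
  have "subgroup (scalars n) (GL n)"
  proof (rule subgroupI)
    show "scalars n \<noteq> {}" by (auto simp: scalars_def intro: exI[of _ 1])
  next
    fix x assume x: "x \<in> scalars n"
    then obtain c where c: "x = c \<cdot>\<^sub>m 1\<^sub>m n" "c \<noteq> 0" by (auto simp: scalars_def)
    have y: "(1 / c) \<cdot>\<^sub>m 1\<^sub>m n \<in> scalars n" using c by (auto simp: scalars_def)
    have "inv\<^bsub>GL n\<^esub> x = (1 / c) \<cdot>\<^sub>m 1\<^sub>m n"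
      by (rule inv_equality) (use c x y sub in \<open>auto simp: mult one prod\<close>)
    then show "inv\<^bsub>GL n\<^esub> x \<in> scalars n" using y by simp
  next
    fix x y assume "x \<in> scalars n" "y \<in> scalars n"
    then obtain c d where "x = c \<cdot>\<^sub>m 1\<^sub>m n" "y = d \<cdot>\<^sub>m 1\<^sub>m n" "c \<noteq> 0" "d \<noteq> 0"
      by (auto simp: scalars_def)
    then show "x \<otimes>\<^bsub>GL n\<^esub> y \<in> scalars n"
      by (auto simp: mult scalars_def prod intro!: exI[of _ "c * d"])
  qed (rule sub)
  moreover have "x \<otimes>\<^bsub>GL n\<^esub> h \<otimes>\<^bsub>GL n\<^esub> inv\<^bsub>GL n\<^esub> x \<in> scalars n"
    if x: "x \<in> carrier (GL n)" and h: "h \<in> scalars n" for x h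
  proof -
    have xn: "x \<in> carrier_mat n n" using x car by auto
    obtain c where "h = c \<cdot>\<^sub>m 1\<^sub>m n" using h by (auto simp: scalars_def)
    then have "x * h = h * x"
      using xn by (simp add: mult_smult_distrib[OF xn one_carrier_mat] mult_smult_assoc_mat[OF one_carrier_mat xn])
    then have "x \<otimes>\<^bsub>GL n\<^esub> h \<otimes>\<^bsub>GL n\<^esub> inv\<^bsub>GL n\<^esub> x = h"
      using x h sub by (simp add: mult[symmetric] m_assoc subset_iff)
    then show ?thesis using h by simp
  qed
  ultimately show ?thesis by (simp add: normal_inv_iff)
qed

lemma group_PGL: "group (PGL n)"
  unfolding PGL_def by (rule normal.factorgroup_is_group[OF scalars_normal])

end

theory Submission
  imports Defs "HOL-Number_Theory.Cong"
begin

text \<open>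
  The space \<open>H\<close> is the sum of two invariant subspaces. The vectors \<open>1 - Z\<close>, \<open>X + X'\<close> and
  \<open>X - X'\<close> are permuted by \<open>sigma\<close> and \<open>tau\<close> up to powers of \<open>\<psi>\<close>, an eighth root of unity. The
  span of \<open>1 + Z\<close> and the \<open>Y\<^sub>j\<close> is the space of functions on \<open>\<int>/p\<close> modulo the odd functions, on
  which \<open>sigma\<close> acts as the unitary discrete Fourier transform and \<open>tau\<close> as multiplication by the
  Gaussian \<open>\<theta>\<^sub>j = \<zeta>^(r j\<^sup>2)\<close>: it is a quotient of the Weil representation
  (\<open>rho_sigma_tqft_vec\<close>, \<open>rho_tau_tqft_vec\<close>).

  Finiteness comes from a finite set of vectors that contains the unit vectors and is mapped into
  itself by both generators. In the Weil part it is made of the point masses and the chirps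
  \<open>j \<mapsto> \<zeta>^(a j\<^sup>2 + b j) / sqrt p\<close>, multiplied by roots of unity and, to
  reach the unit vectors, by \<open>0\<close> and \<open>1/2\<close>. Multiplication by \<open>\<theta>\<close> shifts \<open>a\<close>; the Fourier transform exchanges point masses with the chirps of \<open>a = 0\<close>, and for \<open>a \<noteq> 0\<close>
  completing the square shows that it yields another chirp times the normalized Gauss sum
  \<open>g(a) / sqrt p\<close> (\<open>dft_quadratic_chirp\<close>). The set stays finite because this number is a root of
  unity: \<open>g(a) g(-a) = p\<close>, and \<open>g(a)\<^sup>2 = g(-a)\<^sup>2\<close> because \<open>-1\<close> is a sum of two squares modulo \<open>p\<close>
  (\<open>normalized_gauss_sum_power4\<close>).

  The matrices in \<open>GL\<close> preserving such a set form a finite subgroup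
  (\<open>finite_stabilizer_subgroup\<close>). As \<open>sigma\<close> and \<open>tau\<close> generate \<open>SL(2,\<int>)\<close>
  (\<open>subgroup_SL2Z_eq\<close>), the image of the representation lies in the image of this finite subgroup.
\<close>

section \<open>Generation of SL(2,Z)\<close>

abbreviation mat2 :: "int \<Rightarrow> int \<Rightarrow> int \<Rightarrow> int \<Rightarrow> int mat" where
  "mat2 a b c d \<equiv> mat_of_rows_list 2 [[a, b], [c, d]]"

lemma mat2_mult:
  "mat2 a b c d * mat2 a' b' c' d' = mat2 (a*a' + b*c') (a*b' + b*d') (c*a' + d*c') (c*b' + d*d')"
  by (rule eq_matI)
    (auto simp: mat_of_rows_list_def scalar_prod_def numeral_2_eq_2 less_Suc_eq)

lemma det_mat2: "det (mat2 a b c d) = a * d - b * c"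
  by (simp add: mat_of_rows_list_def laplace_expansion_row[of _ 2 0] cofactor_def mat_delete_def
      numeral_2_eq_2 det_single)

lemma mat2_carrier: "mat2 a b c d \<in> carrier SL2Z \<longleftrightarrow> a * d - b * c = 1"
  using det_mat2[of a b c d] by (auto simp: SL2Z_def mat_of_rows_list_def)

lemma mat2_cases:
  assumes "M \<in> carrier SL2Z"
  obtains a b c d where "M = mat2 a b c d" "a * d - b * c = 1"
proof -
  have "M = mat2 (M $$ (0,0)) (M $$ (0,1)) (M $$ (1,0)) (M $$ (1,1))"
    using assms by (intro eq_matI)
      (auto simp: SL2Z_def mat_of_rows_list_def numeral_2_eq_2 less_Suc_eq)
  then show ?thesis using that assms mat2_carrier by metis
qed

text \<open>
  Euclid's algorithm on the first column: multiplying from the left by a power of \<open>tau\<close> reduces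
  the upper left entry modulo the lower left one, and \<open>sigma\<close> exchanges the two up to sign. When
  the lower left entry has become \<open>0\<close>, the matrix is \<open>\<plusminus>1\<close> times a power of \<open>tau\<close>, and
  \<open>sigma\<^sup>2 = -1\<close>.
\<close>

lemma subgroup_SL2Z_eq:
  assumes H: "subgroup H SL2Z" and sigma: "sigma \<in> H" and tau: "tau \<in> H"
  shows "H = carrier SL2Z"
proof
  interpret SL: group SL2Z by (rule group_SL2Z)
  interpret H: subgroup H SL2Z by (rule H)
  have mult: "M * N \<in> H" if "M \<in> H" "N \<in> H" for M N
    using H.m_closed[OF that] by (simp add: SL2Z_def)
  have sigma_eq: "sigma = mat2 0 (-1) 1 0" and tau_eq: "tau = mat2 1 1 0 1"
    by (simp_all add: sigma_def tau_def)
  have one_eq: "mat2 1 0 0 1 = \<one>\<^bsub>SL2Z\<^esub>"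
    by (rule eq_matI) (auto simp: SL2Z_def mat_of_rows_list_def numeral_2_eq_2 less_Suc_eq)
  have "inv\<^bsub>SL2Z\<^esub> tau = mat2 1 (-1) 0 1"
  proof (rule SL.inv_equality)
    have "mat2 1 (-1) 0 1 * tau = mat2 1 0 0 1" by (simp add: tau_eq mat2_mult)
    then show "mat2 1 (-1) 0 1 \<otimes>\<^bsub>SL2Z\<^esub> tau = \<one>\<^bsub>SL2Z\<^esub>"
      unfolding one_eq by (simp add: SL2Z_def)
  qed (use tau in \<open>auto simp: mat2_carrier\<close>)
  then have tau_inv: "mat2 1 (-1) 0 1 \<in> H" using H.m_inv_closed[OF tau] by simp
  have translation: "mat2 1 n 0 1 \<in> H" for n
  proof (induction n rule: int_induct[where k = 0])
    case base
    show ?case using H.one_closed by (simp add: one_eq)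
  next
    case (step1 n)
    then show ?case using mult[OF step1(2) tau] by (simp add: tau_eq mat2_mult add.commute)
  next
    case (step2 n)
    then show ?case using mult[OF step2(2) tau_inv] by (simp add: mat2_mult)
  qed
  have "mat2 a b c d \<in> H" if "a * d - b * c = 1" for a b c d
    using that
  proof (induction "nat \<bar>c\<bar>" arbitrary: a b c d rule: less_induct)
    case less
    show ?case
    proof (cases "c = 0")
      case True
      then have "(a = 1 \<and> d = 1) \<or> (a = -1 \<and> d = -1)"
        using less.prems by (simp add: zmult_eq_1_iff)
      then show ?thesis
      proof
        assume "a = 1 \<and> d = 1"
        then show ?thesis using True translation by simp
      next
        assume "a = -1 \<and> d = -1"
        moreover have "sigma * (sigma * mat2 1 (-b) 0 1) \<in> H"
          by (intro mult sigma translation)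
        ultimately show ?thesis using True by (simp add: sigma_eq mat2_mult)
      qed
    next
      case False
      define q where "q = a div c"
      have rem: "a - q * c = a mod c" by (simp add: q_def minus_div_mult_eq_mod)
      \<comment> \<open>One step of Euclid's algorithm on the first column, followed by the swap \<open>sigma\<close>.\<close>
      have "mat2 (-c) (-d) (a - q * c) (b - q * d) \<in> H"
      proof (rule less.hyps)
        show "nat \<bar>a - q * c\<bar> < nat \<bar>c\<bar>"
          using False abs_mod_less[of c a] by (simp add: rem)
        show "(-c) * (b - q * d) - (-d) * (a - q * c) = 1"
          using less.prems by (simp add: algebra_simps)
      qed
      then have "mat2 1 q 0 1 * (sigma * (sigma * (sigma * mat2 (-c) (-d) (a - q * c) (b - q * d)))) \<in> H"
        by (intro mult sigma translation)
      then show ?thesis by (simp add: sigma_eq mat2_mult)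
    qed
  qed
  then show "carrier SL2Z \<subseteq> H" by (metis mat2_cases subsetI)
  show "H \<subseteq> carrier SL2Z" by (rule H.subset)
qed

section \<open>Finite subgroups of GL and images in PGL\<close>

lemma GL_mult: "M \<otimes>\<^bsub>GL n\<^esub> N = M * N"
  by (simp add: GL_def units_of_def ring_mat_def)

lemma GL_one: "\<one>\<^bsub>GL n\<^esub> = 1\<^sub>m n"
  by (simp add: GL_def units_of_def ring_mat_def)

lemma GL_carrier_mat: "M \<in> carrier (GL n) \<Longrightarrow> M \<in> carrier_mat n n"
  by (auto simp: GL_def units_of_def Units_def ring_mat_def)

lemma group_hom_proj_class: "group_hom (GL n) (PGL n) (proj_class n)"
proof -
  have "proj_class n = (#>\<^bsub>GL n\<^esub>) (scalars n)" by (auto simp: proj_class_def)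
  then show ?thesis
    using normal.r_coset_hom_Mod[OF scalars_normal[of n]] group_GL group_PGL
    by (simp add: group_hom_def group_hom_axioms_def PGL_def)
qed

text \<open>
  A class in \<open>PGL\<close> is a coset of the scalars inside \<open>GL\<close>, and it contains its representative. So
  the invertibility of the matrices that represent \<open>sigma\<close> and \<open>tau\<close> follows from the mere fact
  that their classes are values of a homomorphism into \<open>PGL\<close>.
\<close>

lemma in_GL_if_proj_class_in_PGL:
  assumes M: "M \<in> carrier_mat n n" and cls: "proj_class n M \<in> carrier (PGL n)"
  shows "M \<in> carrier (GL n)"
proof -
  have "M = 1\<^sub>m n \<otimes>\<^bsub>GL n\<^esub> M" using M by (simp add: GL_mult)
  moreover have "1\<^sub>m n \<in> scalars n" unfolding scalars_def by (auto intro!: exI[of _ 1])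
  ultimately have "M \<in> proj_class n M" unfolding proj_class_def r_coset_def by blast
  moreover have "proj_class n M \<subseteq> carrier (GL n)"
    using subgroup.rcosets_carrier[OF normal_imp_subgroup[OF scalars_normal] group_GL] cls
    by (simp add: PGL_def FactGroup_def)
  ultimately show ?thesis by blast
qed

text \<open>
  The elements of \<open>SL(2,\<int>)\<close> whose image has a representative in \<open>K\<close> form a subgroup, as the
  preimage of a subgroup; it contains the generators.
\<close>

lemma finite_image_if_generators_in_finite_subgroup:
  assumes rho: "rho \<in> hom SL2Z (PGL n)"
    and K: "subgroup K (GL n)" "finite K"
    and sigma: "rho sigma \<in> proj_class n ` K" and tau: "rho tau \<in> proj_class n ` K"
  shows "finite (rho ` carrier SL2Z)"
proof -
  interpret SL: group SL2Z by (rule group_SL2Z)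
  interpret rho: group_hom SL2Z "PGL n" rho
    using rho group_SL2Z group_PGL by (simp add: group_hom_def group_hom_axioms_def)
  interpret L: subgroup "proj_class n ` K" "PGL n"
    by (rule group_hom.subgroup_img_is_subgroup[OF group_hom_proj_class K(1)])
  let ?H = "{M \<in> carrier SL2Z. rho M \<in> proj_class n ` K}"
  have "subgroup ?H SL2Z"
  proof (rule SL.subgroupI)
    show "?H \<noteq> {}" using sigma sigma_in_SL2Z by blast
  qed auto
  then have "?H = carrier SL2Z"
    by (rule subgroup_SL2Z_eq) (use sigma tau sigma_in_SL2Z tau_in_SL2Z in auto)
  then have "rho ` carrier SL2Z \<subseteq> proj_class n ` K" by blast
  then show ?thesis using K(2) finite_surj by blast
qed

lemma finite_vecs:
  assumes "finite S" shows "finite {v \<in> carrier_vec n. \<forall>i<n. v $ i \<in> S}"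
proof (rule finite_surj)
  show "finite {xs. set xs \<subseteq> S \<and> length xs = n}" by (rule finite_lists_length_eq[OF assms])
  show "{v \<in> carrier_vec n. \<forall>i<n. v $ i \<in> S} \<subseteq> vec_of_list ` {xs. set xs \<subseteq> S \<and> length xs = n}"
  proof
    fix v assume v: "v \<in> {v \<in> carrier_vec n. \<forall>i<n. v $ i \<in> S}"
    then have "v = vec_of_list (list_of_vec v)" by (simp add: vec_list)
    moreover have "set (list_of_vec v) \<subseteq> S" using v by (auto simp: set_list_of_vec vec_set_def)
    ultimately show "v \<in> vec_of_list ` {xs. set xs \<subseteq> S \<and> length xs = n}" using v by auto
  qed
qed

text \<open>
  A matrix is determined by its columns, the images of the unit vectors, and all these lie in the
  finite set \<open>E\<close>. This reduces the finiteness of a linear group to finding one finite invariant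
  set of vectors that contains the unit vectors.
\<close>

lemma finite_stabilizer_subgroup:
  assumes fin: "finite E" and E: "E \<subseteq> carrier_vec n" and unit: "\<And>i. i < n \<Longrightarrow> unit_vec n i \<in> E"
  defines "K \<equiv> {M \<in> carrier (GL n). \<forall>v\<in>E. M *\<^sub>v v \<in> E}"
  shows "subgroup K (GL n)" and "finite K"
proof -
  interpret GL: group "GL n" by (rule group_GL)
  show "subgroup K (GL n)"
  proof (rule GL.subgroupI)
    have "\<one>\<^bsub>GL n\<^esub> \<in> K" using E GL.one_closed unfolding K_def by (auto simp: GL_one)
    then show "K \<noteq> {}" by blast
  next
    fix M assume M: "M \<in> K"
    then have MG: "M \<in> carrier (GL n)" by (simp add: K_def)
    let ?N = "inv\<^bsub>GL n\<^esub> M"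
    have M': "M \<in> carrier_mat n n" and N': "?N \<in> carrier_mat n n"
      using MG by (auto intro: GL_carrier_mat)
    have NM: "?N *\<^sub>v (M *\<^sub>v v) = v" if "v \<in> E" for v
    proof -
      have "?N * M = 1\<^sub>m n" using GL.l_inv[OF MG] by (simp add: GL_mult GL_one)
      then show ?thesis using that E M' N' by (subst assoc_mult_mat_vec[symmetric]) auto
    qed
    \<comment> \<open>An injective self-map of a finite set is onto, so the inverse preserves \<open>E\<close> as well.\<close>
    have "(\<lambda>v. M *\<^sub>v v) ` E = E"
    proof (rule endo_inj_surj[OF fin])
      show "(\<lambda>v. M *\<^sub>v v) ` E \<subseteq> E" using M by (auto simp: K_def)
      show "inj_on (\<lambda>v. M *\<^sub>v v) E" by (rule inj_on_inverseI) (rule NM)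
    qed
    then have "\<forall>v\<in>E. ?N *\<^sub>v v \<in> E" using NM by (metis imageE)
    then show "?N \<in> K" using MG by (simp add: K_def)
  next
    fix M N assume M: "M \<in> K" and N: "N \<in> K"
    then have "M \<in> carrier_mat n n" "N \<in> carrier_mat n n" by (auto simp: K_def intro: GL_carrier_mat)
    then have "(M * N) *\<^sub>v v = M *\<^sub>v (N *\<^sub>v v)" if "v \<in> E" for v
      using that E by (intro assoc_mult_mat_vec) auto
    moreover have "M * N \<in> carrier (GL n)"
      using M N GL.m_closed[of M N] by (simp add: K_def GL_mult)
    ultimately show "M \<otimes>\<^bsub>GL n\<^esub> N \<in> K" using M N by (simp add: K_def GL_mult)
  qed (auto simp: K_def)
  show "finite K"
  proof (rule finite_surj)
    show "finite {vs. set vs \<subseteq> E \<and> length vs = n}" by (rule finite_lists_length_eq[OF fin])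
    show "K \<subseteq> mat_of_cols n ` {vs. set vs \<subseteq> E \<and> length vs = n}"
    proof
      fix M assume M: "M \<in> K"
      then have Mc: "M \<in> carrier_mat n n" by (auto simp: K_def intro: GL_carrier_mat)
      have "col M i \<in> E" if "i < n" for i
      proof -
        have "col M i = M *\<^sub>v unit_vec n i" using Mc that by (intro eq_vecI) auto
        then show ?thesis using M unit[OF that] by (simp add: K_def)
      qed
      then have "set (cols M) \<subseteq> E" using Mc by (auto simp: cols_def)
      moreover have "M = mat_of_cols n (cols M)" using Mc by auto
      ultimately show "M \<in> mat_of_cols n ` {vs. set vs \<subseteq> E \<and> length vs = n}" using Mc by auto
    qed
  qed
qed

section \<open>Characters of Z/p and Gauss sums\<close>

text \<open>
  The character \<open>k \<mapsto> \<zeta>\<^sup>k\<close> of \<open>\<int>/p\<close>. Functions on \<open>\<int>/p\<close> are represented by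
  \<open>p\<close>-periodic functions on the integers, and sums over \<open>\<int>/p\<close> by sums over \<open>{0..<p}\<close>.
\<close>

definition unity_char :: "nat \<Rightarrow> int \<Rightarrow> complex" where
  "unity_char p k = zeta p powi k"

lemma unity_char_add: "unity_char p (j + k) = unity_char p j * unity_char p k"
  by (simp add: unity_char_def power_int_add zeta_def)

lemma unity_char_0 [simp]: "unity_char p 0 = 1"
  by (simp add: unity_char_def)

lemma unity_char_mult: "unity_char p (j * k) = unity_char p j powi k"
  by (simp add: unity_char_def power_int_mult)

lemma unity_char_eq_1_iff:
  assumes "p > 0" shows "unity_char p k = 1 \<longleftrightarrow> int p dvd k"
proof -
  have "unity_char p k = cis (2 * pi * of_int k / of_nat p)"
    by (simp add: unity_char_def zeta_def exp_power_int cis_conv_exp mult_ac)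
  then have "unity_char p k = 1 \<longleftrightarrow> (\<exists>n::int. 2 * pi * of_int k / of_nat p = of_int n * 2 * pi)"
    by (auto simp: complex_eq_iff cos_one_sin_zero simp flip: cos_one_2pi_int)
  also have "\<dots> \<longleftrightarrow> (\<exists>n::int. real_of_int k = real_of_int (int p * n))"
    using assms by (intro ex_cong1) (auto simp: field_simps)
  also have "\<dots> \<longleftrightarrow> int p dvd k" unfolding of_int_eq_iff by (auto simp: dvd_def)
  finally show ?thesis .
qed

lemma unity_char_cong:
  assumes "p > 0" "[j = k] (mod int p)" shows "unity_char p j = unity_char p k"
proof -
  have "unity_char p (j - k) = 1"
    using assms by (simp add: unity_char_eq_1_iff cong_iff_dvd_diff)
  then show ?thesis using unity_char_add[of p "j - k" k] by simp
qed

lemma unity_char_power: "p > 0 \<Longrightarrow> unity_char p k ^ p = 1"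
  using unity_char_mult[of p k "int p"] unity_char_eq_1_iff[of p "k * int p"] by simp

lemma unity_char_power_8p: "p > 0 \<Longrightarrow> unity_char p k ^ (8 * p) = 1"
  unfolding mult.commute[of 8] power_mult unity_char_power by simp

lemma sum_unity_char:
  assumes "p > 0"
  shows "(\<Sum>j\<in>{0..<int p}. unity_char p (k * j)) = (if int p dvd k then of_nat p else 0)"
proof -
  have "(\<Sum>j\<in>{0..<int p}. unity_char p (k * j)) = (\<Sum>j<p. unity_char p (k * int j))"
    by (rule sum.reindex_bij_witness[of _ int nat]) auto
  also have "\<dots> = (\<Sum>j<p. unity_char p k ^ j)" by (simp add: unity_char_mult)
  also have "\<dots> = (if int p dvd k then of_nat p else 0)"
    using assms by (auto simp: unity_char_eq_1_iff unity_char_power sum_gp_strict)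
  finally show ?thesis .
qed

definition periodic :: "nat \<Rightarrow> (int \<Rightarrow> complex) \<Rightarrow> bool" where
  "periodic p f \<longleftrightarrow> (\<forall>j k. [j = k] (mod int p) \<longrightarrow> f j = f k)"

lemma periodicD: "periodic p f \<Longrightarrow> [j = k] (mod int p) \<Longrightarrow> f j = f k"
  by (simp add: periodic_def)

lemma sum_periodic_shift:
  assumes "p > 0" "periodic p f"
  shows "(\<Sum>j\<in>{0..<int p}. f (j + d)) = (\<Sum>j\<in>{0..<int p}. f j)"
  by (rule sum.reindex_bij_witness[of _ "\<lambda>j. (j - d) mod int p" "\<lambda>j. (j + d) mod int p"])
    (use assms in \<open>auto simp: mod_simps intro!: periodicD[OF assms(2)] simp: cong_def\<close>)

text \<open>
  Residues other than \<open>0\<close> come in pairs \<open>\<plusminus>j\<close>. This is the passage from functions on \<open>\<int>/p\<close> to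
  the basis vectors \<open>Y\<^sub>j\<close>, which correspond to such pairs.
\<close>

lemma sum_periodic_symmetric:
  assumes p: "odd p" and f: "periodic p f"
  shows "(\<Sum>j\<in>{0..<int p}. f j) = f 0 + (\<Sum>j\<in>{1..half p}. f (int j) + f (- int j))"
proof -
  have p_eq: "p = 2 * half p + 1" using p by (auto simp: half_def elim!: oddE)
  have split: "{..<p} = insert 0 ({1..half p} \<union> {half p + 1..<p})" using p_eq by auto
  have upper: "(\<Sum>j\<in>{half p + 1..<p}. f (int j)) = (\<Sum>j\<in>{1..half p}. f (- int j))"
  proof (rule sum.reindex_bij_witness[of _ "\<lambda>j. p - j" "\<lambda>j. p - j"])
    fix j assume "j \<in> {half p + 1..<p}"
    then show "f (- int (p - j)) = f (int j)"
      by (intro periodicD[OF f]) (auto simp: cong_iff_dvd_diff of_nat_diff)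
  qed (use p_eq in auto)
  have "(\<Sum>j\<in>{0..<int p}. f j) = (\<Sum>j<p. f (int j))"
    by (rule sum.reindex_bij_witness[of _ int nat]) auto
  also have "\<dots> = f 0 + ((\<Sum>j\<in>{1..half p}. f (int j)) + (\<Sum>j\<in>{half p + 1..<p}. f (int j)))"
    unfolding split by (subst sum.insert) (auto intro!: sum.union_disjoint)
  finally show ?thesis unfolding upper sum.distrib .
qed

definition gauss_sum :: "nat \<Rightarrow> int \<Rightarrow> complex" where
  "gauss_sum p a = (\<Sum>j\<in>{0..<int p}. unity_char p (a * j\<^sup>2))"

lemma periodic_quadratic:
  assumes "p > 0" shows "periodic p (\<lambda>j. unity_char p (a * j\<^sup>2 + b * j + c))"
  unfolding periodic_def
  by (auto intro!: unity_char_cong[OF assms] cong_add cong_mult cong_pow)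

text \<open>
  Completing the square, where \<open>a'\<close> plays the part of \<open>1/(4a)\<close>:
  \<open>a j\<^sup>2 + m j = a (j + 2 a' m)\<^sup>2 - a' m\<^sup>2\<close> modulo \<open>p\<close>.
\<close>

lemma sum_quadratic_unity_char:
  assumes p: "p > 0" and inv: "[4 * a * a' = 1] (mod int p)"
  shows "(\<Sum>j\<in>{0..<int p}. unity_char p (a * j\<^sup>2 + m * j)) = unity_char p (- a' * m\<^sup>2) * gauss_sum p a"
proof -
  have sq: "unity_char p (a * j\<^sup>2 + m * j) = unity_char p (a * (j + 2 * a' * m)\<^sup>2 + 0 * (j + 2 * a' * m) + (- a' * m\<^sup>2))" for j
  proof (rule unity_char_cong[OF p], rule cong_sym)
    have "(a * (j + 2 * a' * m)\<^sup>2 + 0 * (j + 2 * a' * m) + (- a' * m\<^sup>2)) - (a * j\<^sup>2 + m * j)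
        = (4 * a * a' - 1) * (m * j + a' * m\<^sup>2)"
      by (simp add: power2_eq_square algebra_simps)
    then show "[a * (j + 2 * a' * m)\<^sup>2 + 0 * (j + 2 * a' * m) + (- a' * m\<^sup>2) = a * j\<^sup>2 + m * j] (mod int p)"
      using inv by (simp add: cong_iff_dvd_diff)
  qed
  have "(\<Sum>j\<in>{0..<int p}. unity_char p (a * j\<^sup>2 + m * j))
      = (\<Sum>j\<in>{0..<int p}. unity_char p (a * j\<^sup>2 + 0 * j + (- a' * m\<^sup>2)))"
    unfolding sq by (rule sum_periodic_shift[OF p periodic_quadratic[OF p]])
  also have "\<dots> = unity_char p (- a' * m\<^sup>2) * gauss_sum p a"
    unfolding gauss_sum_def sum_distrib_left
    by (intro sum.cong refl) (simp add: unity_char_add[symmetric] add.commute)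
  finally show ?thesis .
qed

lemma odd_prime_not_dvd_2: "prime p \<Longrightarrow> odd p \<Longrightarrow> \<not> int p dvd 2"
  by (metis even_of_nat int_dvd_int_iff of_nat_numeral primes_dvd_imp_eq two_is_prime_nat)

lemma gauss_sum_times_uminus:
  assumes p: "prime p" "odd p" and a: "\<not> int p dvd a"
  shows "gauss_sum p a * gauss_sum p (- a) = of_nat p"
proof -
  have p0: "p > 0" using p(1) prime_gt_0_nat by blast
  have dvd: "int p dvd 2 * a * d \<longleftrightarrow> d = 0" if "d \<in> {0..<int p}" for d
  proof -
    have "int p dvd 2 * a * d \<longleftrightarrow> int p dvd d"
      using a p(1) odd_prime_not_dvd_2[OF p] by (simp add: prime_dvd_mult_iff)
    also have "\<dots> \<longleftrightarrow> d = 0" using that zdvd_not_zless[of d "int p"] by (cases "d = 0") auto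
    finally show ?thesis .
  qed
  have "gauss_sum p a * gauss_sum p (- a)
      = (\<Sum>y\<in>{0..<int p}. \<Sum>x\<in>{0..<int p}. unity_char p (a * x\<^sup>2 + 0 * x + (- a * y\<^sup>2)))"
    unfolding gauss_sum_def sum_product
    by (subst sum.swap) (simp add: unity_char_add[symmetric])
  \<comment> \<open>Substituting \<open>x = d + y\<close> turns \<open>x\<^sup>2 - y\<^sup>2\<close> into an expression linear in \<open>y\<close>.\<close>
  also have "\<dots> = (\<Sum>y\<in>{0..<int p}. \<Sum>d\<in>{0..<int p}. unity_char p (a * (d + y)\<^sup>2 + 0 * (d + y) + (- a * y\<^sup>2)))"
    by (intro sum.cong refl sum_periodic_shift[OF p0 periodic_quadratic[OF p0], symmetric])
  also have "\<dots> = (\<Sum>y\<in>{0..<int p}. \<Sum>d\<in>{0..<int p}. unity_char p (a * d\<^sup>2) * unity_char p (2 * a * d * y))"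
    by (intro sum.cong refl) (simp add: unity_char_add[symmetric] power2_eq_square algebra_simps)
  also have "\<dots> = (\<Sum>d\<in>{0..<int p}. unity_char p (a * d\<^sup>2) * (\<Sum>y\<in>{0..<int p}. unity_char p (2 * a * d * y)))"
    by (subst sum.swap) (simp add: sum_distrib_left)
  also have "\<dots> = (\<Sum>d\<in>{0..<int p}. if d = 0 then of_nat p else 0)"
    by (intro sum.cong refl, subst sum_unity_char[OF p0]) (simp add: dvd)
  also have "\<dots> = of_nat p" using p0 by simp
  finally show ?thesis .
qed

text \<open>
  Pigeonhole principle: with \<open>r = (p - 1)/2\<close>, the \<open>r + 1\<close> squares and the \<open>r + 1\<close> numbers of the
  form \<open>-1 - t\<^sup>2\<close> modulo \<open>p\<close> cannot all be distinct, since \<open>2 r + 2 > p\<close>.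
\<close>

lemma minus_one_sum_of_two_squares:
  assumes p: "prime p" "odd p"
  obtains s t :: int where "[s\<^sup>2 + t\<^sup>2 = -1] (mod int p)"
proof -
  have p_eq: "p = 2 * half p + 1" using p(2) by (auto simp: half_def elim!: oddE)
  let ?P = "int p" and ?I = "{0..int (half p)}"
  define A where "A = (\<lambda>x. x\<^sup>2 mod ?P) ` ?I"
  define B where "B = (\<lambda>x. (- 1 - x\<^sup>2) mod ?P) ` ?I"
  have inj: "x = y" if xy: "x \<in> ?I" "y \<in> ?I" and sq: "[x\<^sup>2 = y\<^sup>2] (mod ?P)" for x y
  proof -
    have "?P dvd (x - y) * (x + y)"
      using sq by (simp add: cong_iff_dvd_diff power2_eq_square algebra_simps)
    then have "?P dvd x - y \<or> ?P dvd x + y" using p(1) by (simp add: prime_dvd_mult_iff)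
    then show "x = y"
    proof
      assume "?P dvd x - y"
      then show ?thesis using xy p_eq zdvd_imp_le[of ?P "x - y"] zdvd_imp_le[of ?P "y - x"]
        by (cases x y rule: linorder_cases) (auto simp: dvd_diff_commute)
    next
      assume "?P dvd x + y"
      then show ?thesis using xy p_eq zdvd_imp_le[of ?P "x + y"] by (cases "x + y > 0") auto
    qed
  qed
  have "card A = half p + 1"
    unfolding A_def by (subst card_image) (auto intro!: inj_onI inj simp: cong_def)
  moreover have "card B = half p + 1"
    unfolding B_def
  proof (subst card_image)
    show "inj_on (\<lambda>x. (- 1 - x\<^sup>2) mod ?P) ?I"
    proof (rule inj_onI)
      fix x y assume xy: "x \<in> ?I" "y \<in> ?I" "(- 1 - x\<^sup>2) mod ?P = (- 1 - y\<^sup>2) mod ?P"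
      then have "?P dvd (- 1 - x\<^sup>2) - (- 1 - y\<^sup>2)" by (simp add: mod_eq_dvd_iff)
      then have "[x\<^sup>2 = y\<^sup>2] (mod ?P)" by (simp add: cong_iff_dvd_diff dvd_diff_commute)
      then show "x = y" using inj xy by blast
    qed
  qed simp
  moreover have "card (A \<union> B) \<le> p"
  proof -
    have "A \<union> B \<subseteq> {0..<?P}" using prime_gt_0_nat[OF p(1)] by (auto simp: A_def B_def)
    then have "card (A \<union> B) \<le> card {0..<?P}" by (intro card_mono) auto
    then show ?thesis by simp
  qed
  ultimately have "A \<inter> B \<noteq> {}"
    using card_Un_disjoint[of A B] p_eq by (auto simp: A_def B_def)
  then obtain s t where "s\<^sup>2 mod ?P = (- 1 - t\<^sup>2) mod ?P" by (auto simp: A_def B_def)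
  then have "[s\<^sup>2 + t\<^sup>2 = -1] (mod ?P)" by (simp add: mod_eq_dvd_iff cong_iff_dvd_diff algebra_simps)
  then show ?thesis using that by blast
qed

text \<open>
  The square of a Gauss sum is a sum over pairs, with the norm form \<open>x\<^sup>2 + y\<^sup>2\<close> in the exponent.
  If \<open>s\<^sup>2 + t\<^sup>2 = -1\<close> modulo \<open>p\<close>, then multiplication by \<open>s + t i\<close>, that is
  \<open>(x, y) \<mapsto> (s x - t y, t x + s y)\<close>, is a bijection of these pairs which changes the sign of the
  norm form. Multiplication by \<open>-(s - t i)\<close> is its inverse.
\<close>

lemma gauss_sum_uminus_square:
  assumes p: "prime p" "odd p"
  shows "gauss_sum p (- a) ^ 2 = gauss_sum p a ^ 2"
proof -
  have p0: "p > 0" using p(1) prime_gt_0_nat by blast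
  let ?P = "int p" let ?Q = "{0..<?P} \<times> {0..<?P}"
  obtain s t where st: "[s\<^sup>2 + t\<^sup>2 = -1] (mod ?P)" using minus_one_sum_of_two_squares[OF p] .
  have sq: "gauss_sum p c ^ 2 = (\<Sum>(x, y)\<in>?Q. unity_char p (c * (x\<^sup>2 + y\<^sup>2)))" for c
  proof -
    have "gauss_sum p c ^ 2 = gauss_sum p c * gauss_sum p c" by (rule power2_eq_square)
    also have "\<dots> = (\<Sum>(x, y)\<in>?Q. unity_char p (c * x\<^sup>2) * unity_char p (c * y\<^sup>2))"
      unfolding gauss_sum_def sum_product sum.cartesian_product ..
    finally show ?thesis by (simp add: unity_char_add distrib_left)
  qed
  have norm: "[(s * x - t * y)\<^sup>2 + (t * x + s * y)\<^sup>2 = - (x\<^sup>2 + y\<^sup>2)] (mod ?P)" for x y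
  proof -
    have "(s * x - t * y)\<^sup>2 + (t * x + s * y)\<^sup>2 = (s\<^sup>2 + t\<^sup>2) * (x\<^sup>2 + y\<^sup>2)"
      by (simp add: power2_eq_square algebra_simps)
    then show ?thesis using cong_mult[OF st cong_refl, of "x\<^sup>2 + y\<^sup>2"] by simp
  qed
  \<comment> \<open>The two compositions of the linear maps are multiplication by \<open>-(s\<^sup>2 + t\<^sup>2) = 1\<close> modulo \<open>p\<close>.\<close>
  have neg: "(- (s\<^sup>2 + t\<^sup>2) * z) mod ?P = z mod ?P" for z
    using cong_mult[OF st[THEN cong_minus_minus_iff[THEN iffD2]] cong_refl, of z]
    by (simp add: cong_def)
  have inv: "(- (s * (s * x - t * y)) - t * (t * x + s * y)) mod ?P = x mod ?P"
    "(t * (s * x - t * y) - s * (t * x + s * y)) mod ?P = y mod ?P"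
    "(s * (- (s * x) - t * y) - t * (t * x - s * y)) mod ?P = x mod ?P"
    "(t * (- (s * x) - t * y) + s * (t * x - s * y)) mod ?P = y mod ?P" for x y
  proof -
    have "- (s * (s * x - t * y)) - t * (t * x + s * y) = - (s\<^sup>2 + t\<^sup>2) * x"
      "t * (s * x - t * y) - s * (t * x + s * y) = - (s\<^sup>2 + t\<^sup>2) * y"
      "s * (- (s * x) - t * y) - t * (t * x - s * y) = - (s\<^sup>2 + t\<^sup>2) * x"
      "t * (- (s * x) - t * y) + s * (t * x - s * y) = - (s\<^sup>2 + t\<^sup>2) * y"
      by (simp_all add: power2_eq_square algebra_simps)
    then show "(- (s * (s * x - t * y)) - t * (t * x + s * y)) mod ?P = x mod ?P"
      "(t * (s * x - t * y) - s * (t * x + s * y)) mod ?P = y mod ?P"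
      "(s * (- (s * x) - t * y) - t * (t * x - s * y)) mod ?P = x mod ?P"
      "(t * (- (s * x) - t * y) + s * (t * x - s * y)) mod ?P = y mod ?P"
      by (simp_all only: neg)
  qed
  have lin: "(- (s * (x mod ?P)) - t * (y mod ?P)) mod ?P = (- (s * x) - t * y) mod ?P"
    "(t * (x mod ?P) - s * (y mod ?P)) mod ?P = (t * x - s * y) mod ?P"
    "(s * (x mod ?P) - t * (y mod ?P)) mod ?P = (s * x - t * y) mod ?P"
    "(t * (x mod ?P) + s * (y mod ?P)) mod ?P = (t * x + s * y) mod ?P" for x y
    unfolding cong_def[symmetric]
    by (intro cong_add cong_diff cong_mult cong_minus_minus_iff[THEN iffD2]; simp)+
  show ?thesis unfolding sq
  proof (rule sum.reindex_bij_witness[of _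
        "\<lambda>(x, y). ((- (s * x) - t * y) mod ?P, (t * x - s * y) mod ?P)"
        "\<lambda>(x, y). ((s * x - t * y) mod ?P, (t * x + s * y) mod ?P)"])
    fix xy assume "xy \<in> ?Q"
    then obtain x y where xy: "xy = (x, y)" "x \<in> {0..<?P}" "y \<in> {0..<?P}" by auto
    have "[a * (((s * x - t * y) mod ?P)\<^sup>2 + ((t * x + s * y) mod ?P)\<^sup>2) = a * - (x\<^sup>2 + y\<^sup>2)] (mod ?P)"
      by (intro cong_mult[OF cong_refl] cong_trans[OF _ norm] cong_add cong_pow) (simp_all add: cong_def)
    then have "unity_char p (a * (((s * x - t * y) mod ?P)\<^sup>2 + ((t * x + s * y) mod ?P)\<^sup>2))
        = unity_char p (- a * (x\<^sup>2 + y\<^sup>2))"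
      using unity_char_cong[OF p0] by (metis mult_minus_left mult_minus_right)
    then show "(case case xy of (x, y) \<Rightarrow> ((s * x - t * y) mod ?P, (t * x + s * y) mod ?P) of
          (x, y) \<Rightarrow> unity_char p (a * (x\<^sup>2 + y\<^sup>2))) = (case xy of (x, y) \<Rightarrow> unity_char p (- a * (x\<^sup>2 + y\<^sup>2)))"
      by (simp add: xy(1))
    show "(case case xy of (x, y) \<Rightarrow> ((s * x - t * y) mod ?P, (t * x + s * y) mod ?P) of
          (x, y) \<Rightarrow> ((- (s * x) - t * y) mod ?P, (t * x - s * y) mod ?P)) = xy"
      using xy inv(1,2)[of x y] by (simp add: lin)
    show "(case case xy of (x, y) \<Rightarrow> ((- (s * x) - t * y) mod ?P, (t * x - s * y) mod ?P) of
          (x, y) \<Rightarrow> ((s * x - t * y) mod ?P, (t * x + s * y) mod ?P)) = xy"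
      using xy inv(3,4)[of x y] by (simp add: lin)
  qed (use p0 in auto)
qed

lemma rsqrt_square: "rsqrt p ^ 2 = 1 / of_nat p"
  by (simp add: rsqrt_def power_divide flip: of_real_power)

text \<open>
  By \<open>gauss_sum_times_uminus\<close> and \<open>gauss_sum_uminus_square\<close>,
  \<open>g(a)\<^sup>4 = (g(a) g(-a))\<^sup>2 = p\<^sup>2\<close>. So the
  scalar by which the Fourier transform multiplies a chirp is a root of unity.
\<close>

lemma normalized_gauss_sum_power4:
  assumes p: "prime p" "odd p" and a: "\<not> int p dvd a"
  shows "(rsqrt p * gauss_sum p a) ^ 4 = 1"
proof -
  have p0: "p > 0" using p(1) prime_gt_0_nat by blast
  have "gauss_sum p a ^ 4 = gauss_sum p a ^ 2 * gauss_sum p (- a) ^ 2"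
    by (simp add: gauss_sum_uminus_square[OF p])
  also have "\<dots> = of_nat p ^ 2"
    by (simp add: gauss_sum_times_uminus[OF p a] flip: power_mult_distrib)
  finally have "gauss_sum p a ^ 4 = of_nat p ^ 2" .
  moreover have "rsqrt p ^ 4 = (1 / of_nat p) ^ 2" by (simp flip: rsqrt_square power_mult)
  ultimately show ?thesis using p0 by (simp add: power_mult_distrib power_divide)
qed

section \<open>The Fourier transform of chirps\<close>

definition dft :: "nat \<Rightarrow> (int \<Rightarrow> complex) \<Rightarrow> int \<Rightarrow> complex" where
  "dft p f k = rsqrt p * (\<Sum>j\<in>{0..<int p}. unity_char p (j * k) * f j)"

definition delta :: "nat \<Rightarrow> int \<Rightarrow> int \<Rightarrow> complex" where
  "delta p m j = (if [j = m] (mod int p) then 1 else 0)"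

text \<open>
  Chirps with \<open>a\<close> divisible by \<open>p\<close> are, up to scale, the additive characters. The factor \<open>1 / sqrt p\<close> gives
  chirps the same norm as point masses, so that the unitary Fourier transform can exchange them
  up to roots of unity.
\<close>

definition chirp :: "nat \<Rightarrow> int \<Rightarrow> int \<Rightarrow> int \<Rightarrow> complex" where
  "chirp p a b j = rsqrt p * unity_char p (a * j\<^sup>2 + b * j)"

lemma periodic_delta: "periodic p (delta p m)"
  by (auto simp: periodic_def delta_def cong_def)

lemma periodic_chirp: "p > 0 \<Longrightarrow> periodic p (chirp p a b)"
  using periodic_quadratic[of p a b 0] by (simp add: periodic_def chirp_def)

lemma dft_scale: "dft p (\<lambda>j. w * f j) = (\<lambda>k. w * dft p f k)"
  by (rule ext) (simp add: dft_def sum_distrib_left mult_ac)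

lemma dft_delta:
  assumes "p > 0" shows "dft p (delta p m) = chirp p 0 m"
proof
  fix k
  have "(\<Sum>j\<in>{0..<int p}. unity_char p (j * k) * delta p m j)
      = (\<Sum>j\<in>{0..<int p}. if j = m mod int p then unity_char p (m * k) else 0)"
  proof (intro sum.cong refl)
    fix j assume "j \<in> {0..<int p}"
    then have "[j = m] (mod int p) \<longleftrightarrow> j = m mod int p" by (auto simp: cong_def)
    moreover have "unity_char p (j * k) = unity_char p (m * k)" if "[j = m] (mod int p)"
      using that by (intro unity_char_cong assms cong_mult) auto
    ultimately show "unity_char p (j * k) * delta p m j = (if j = m mod int p then unity_char p (m * k) else 0)"
      by (simp add: delta_def)
  qed
  also have "\<dots> = unity_char p (m * k)" using assms by simp
  finally show "dft p (delta p m) k = chirp p 0 m k" by (simp add: dft_def chirp_def)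
qed

lemma dft_chirp_eq:
  "dft p (chirp p a b) k = rsqrt p ^ 2 * (\<Sum>j\<in>{0..<int p}. unity_char p (a * j\<^sup>2 + (b + k) * j))"
  unfolding dft_def chirp_def power2_eq_square[of "rsqrt p"] mult.assoc sum_distrib_left
  by (intro sum.cong refl) (simp add: unity_char_add algebra_simps)

lemma dft_linear_chirp:
  assumes "p > 0" "int p dvd a" shows "dft p (chirp p a b) = delta p (- b)"
proof
  fix k
  have "(\<Sum>j\<in>{0..<int p}. unity_char p (a * j\<^sup>2 + (b + k) * j)) = (\<Sum>j\<in>{0..<int p}. unity_char p ((b + k) * j))"
    using assms(2) by (intro sum.cong refl unity_char_cong[OF assms(1)]) (simp add: cong_iff_dvd_diff)
  also have "\<dots> = (if int p dvd b + k then of_nat p else 0)" by (rule sum_unity_char[OF assms(1)])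
  finally show "dft p (chirp p a b) k = delta p (- b) k"
    using assms(1) by (simp add: dft_chirp_eq rsqrt_square delta_def cong_iff_dvd_diff add.commute)
qed

text \<open>
  The transform of a Gaussian is a Gaussian with the quadratic coefficient inverted; the scalar
  that appears is a normalized Gauss sum times a power of \<open>\<zeta>\<close>.
\<close>

lemma dft_quadratic_chirp:
  assumes p: "prime p" "odd p" and a: "\<not> int p dvd a"
  obtains w a' b' where "w ^ (8 * p) = 1" "dft p (chirp p a b) = (\<lambda>k. w * chirp p a' b' k)"
proof -
  have p0: "p > 0" using p(1) prime_gt_0_nat by blast
  have prime: "prime (int p)" using p(1) by simp
  have four: "4 * a = 2 * (2 * a)" by simp
  have "\<not> int p dvd 4 * a"
    unfolding four prime_dvd_mult_iff[OF prime] using odd_prime_not_dvd_2[OF p] a by blast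
  then have "coprime (4 * a) (int p)"
    using prime prime_imp_coprime[of "int p" "4 * a"] by (simp add: coprime_commute)
  then obtain a' where inv: "[4 * a * a' = 1] (mod int p)" using cong_solve_coprime_int by blast
  define w where "w = unity_char p (- a' * b\<^sup>2) * (rsqrt p * gauss_sum p a)"
  have "(rsqrt p * gauss_sum p a) ^ (8 * p) = 1"
  proof -
    have "8 * p = 4 * (2 * p)" by simp
    then show ?thesis by (simp only: power_mult[of _ 4] normalized_gauss_sum_power4[OF p a] power_one)
  qed
  then have "w ^ (8 * p) = 1" unfolding w_def power_mult_distrib by (simp add: unity_char_power_8p[OF p0])
  moreover have "dft p (chirp p a b) k = w * chirp p (- a') (- 2 * a' * b) k" for k
  proof -
    have "unity_char p (- a' * (b + k)\<^sup>2) = unity_char p (- a' * b\<^sup>2) * unity_char p (- a' * k\<^sup>2 + (- 2 * a' * b) * k)"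
      by (simp add: unity_char_add[symmetric] power2_eq_square algebra_simps)
    then show ?thesis
      by (simp add: dft_chirp_eq sum_quadratic_unity_char[OF p0 inv] w_def chirp_def
          power2_eq_square[of "rsqrt p"])
  qed
  ultimately show ?thesis using that by blast
qed

text \<open>
  The order \<open>8 p\<close> accommodates the powers of \<open>\<zeta>\<close> (order \<open>p\<close>), the normalized Gauss sums
  (order dividing \<open>4\<close>) and \<open>\<psi>\<close> (order dividing \<open>8\<close>). The factors \<open>0\<close> and \<open>1/2\<close> are there
  so that the family of vectors built from these scalars includes the unit vectors.
\<close>

definition root_scalars :: "nat \<Rightarrow> complex set" where
  "root_scalars p = {c * w | c w. c \<in> {0, 1/2, 1} \<and> w ^ (8 * p) = 1}"

definition chirp_family :: "nat \<Rightarrow> (int \<Rightarrow> complex) set" where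
  "chirp_family p = {(\<lambda>j. w * delta p m j) | w m. w \<in> root_scalars p}
    \<union> {(\<lambda>j. w * chirp p a b j) | w a b. w \<in> root_scalars p}"

lemma chirp_familyI:
  assumes "w \<in> root_scalars p"
  shows "(\<lambda>j. w * delta p m j) \<in> chirp_family p" "(\<lambda>j. w * chirp p a b j) \<in> chirp_family p"
  using assms unfolding chirp_family_def by blast+

lemma chirp_family_cases:
  assumes "f \<in> chirp_family p"
  obtains w m where "f = (\<lambda>j. w * delta p m j)" "w \<in> root_scalars p"
    | w a b where "f = (\<lambda>j. w * chirp p a b j)" "w \<in> root_scalars p"
  using assms unfolding chirp_family_def by blast

lemma root_scalars_mem:
  "0 \<in> root_scalars p" "1/2 \<in> root_scalars p" "- 1/2 \<in> root_scalars p" "1 \<in> root_scalars p"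
proof -
  have mem: "c * w \<in> root_scalars p" if "c \<in> {0, 1/2, 1}" "w ^ (8 * p) = 1" for c w
    using that unfolding root_scalars_def by blast
  show "0 \<in> root_scalars p" "1/2 \<in> root_scalars p" "1 \<in> root_scalars p"
    using mem[of 0 1] mem[of "1/2" 1] mem[of 1 1] by simp_all
  show "- 1/2 \<in> root_scalars p" using mem[of "1/2" "-1"] by (simp add: power_mult)
qed

lemma root_scalars_mult:
  assumes z: "z ^ (8 * p) = 1" and w: "w \<in> root_scalars p"
  shows "z * w \<in> root_scalars p"
proof -
  obtain c u where cu: "w = c * u" "c \<in> {0, 1/2, 1}" "u ^ (8 * p) = 1"
    using w unfolding root_scalars_def by blast
  have "z * w = c * (z * u)" by (simp add: cu(1))
  moreover have "(z * u) ^ (8 * p) = 1" by (simp only: power_mult_distrib z cu(3) mult_1)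
  ultimately show ?thesis using cu(2) unfolding root_scalars_def by blast
qed

lemma finite_root_scalars:
  assumes "p > 0" shows "finite (root_scalars p)"
proof -
  have "root_scalars p = (\<Union>c\<in>{0, 1/2, 1}. (*) c ` {w. w ^ (8 * p) = 1})"
    unfolding root_scalars_def by blast
  moreover have "finite {w :: complex. w ^ (8 * p) = 1}" using assms by (intro finite_nth_roots) simp
  moreover have "finite {0, 1/2, 1 :: complex}" by simp
  ultimately show ?thesis by (metis finite_UN_I finite_imageI)
qed

lemma periodic_chirp_family: "p > 0 \<Longrightarrow> f \<in> chirp_family p \<Longrightarrow> periodic p f"
  using periodic_delta[of p] periodic_chirp[of p] by (fastforce simp: chirp_family_def periodic_def)

text \<open>
  The Fourier transform takes point masses to characters, characters to point masses, and genuine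
  chirps to genuine chirps.
\<close>

lemma dft_chirp_family:
  assumes p: "prime p" "odd p" and f: "f \<in> chirp_family p"
  shows "dft p f \<in> chirp_family p"
proof -
  have p0: "p > 0" using p(1) prime_gt_0_nat by blast
  from f show ?thesis
  proof (cases rule: chirp_family_cases)
    case (1 w m)
    then show ?thesis by (simp add: dft_scale dft_delta[OF p0] chirp_familyI)
  next
    case (2 w a b)
    show ?thesis
    proof (cases "int p dvd a")
      case True
      then show ?thesis using 2 by (simp add: dft_scale dft_linear_chirp[OF p0] chirp_familyI)
    next
      case False
      then obtain z a' b' where z: "z ^ (8 * p) = 1" and eq: "dft p (chirp p a b) = (\<lambda>k. z * chirp p a' b' k)"
        using dft_quadratic_chirp[OF p] by metis
      have "dft p f = (\<lambda>k. (z * w) * chirp p a' b' k)"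
        by (simp add: 2(1) dft_scale eq mult_ac)
      then show ?thesis using root_scalars_mult[OF z 2(2)] by (simp only: chirp_familyI)
    qed
  qed
qed

lemma theta_eq: "theta p j = unity_char p (int (half p) * j\<^sup>2)"
  by (simp add: theta_def unity_char_def)

lemma theta_0 [simp]: "theta p 0 = 1" and theta_minus [simp]: "theta p (- j) = theta p j"
  by (simp_all add: theta_eq)

lemma theta_chirp_family:
  assumes p0: "p > 0" and f: "f \<in> chirp_family p"
  shows "(\<lambda>j. theta p j * f j) \<in> chirp_family p"
proof -
  from f show ?thesis
  proof (cases rule: chirp_family_cases)
    case (1 w m)
    have "theta p j * f j = theta p m * w * delta p m j" for j
    proof (cases "[j = m] (mod int p)")
      case True
      then have "theta p j = theta p m"
        unfolding theta_eq by (intro unity_char_cong[OF p0] cong_mult cong_pow cong_refl)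
      then show ?thesis by (simp add: 1)
    qed (simp add: 1 delta_def)
    then show ?thesis using root_scalars_mult[OF unity_char_power_8p[OF p0] 1(2)] by (simp only: theta_eq chirp_familyI)
  next
    case (2 w a b)
    have "theta p j * f j = w * chirp p (int (half p) + a) b j" for j
      by (simp add: 2 theta_eq chirp_def unity_char_add algebra_simps)
    then show ?thesis using 2(2) by (simp only: chirp_familyI)
  qed
qed

section \<open>The action of the generators on H\<close>

text \<open>
  The linear map from the sum of the functions on \<open>\<int>/p\<close> and a three-dimensional space onto \<open>H\<close>
  that sends the point mass at \<open>0\<close> to \<open>1 + Z\<close>, the point masses at \<open>\<plusminus>j\<close> to \<open>Y\<^sub>j\<close>, and the
  standard basis of the second summand to \<open>1 - Z\<close>, \<open>X + X'\<close> and \<open>X - X'\<close>. Position \<open>i\<close> of the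
  vector belongs to \<open>Y\<^sub>i\<^sub>-\<^sub>1\<close> for \<open>2 \<le> i \<le> r + 1\<close>.
\<close>

definition tqft_vec :: "nat \<Rightarrow> (int \<Rightarrow> complex) \<Rightarrow> complex \<Rightarrow> complex \<Rightarrow> complex \<Rightarrow> complex vec" where
  "tqft_vec p f a b c = vec (dimH p) (\<lambda>i.
    if i = 0 then f 0 + a else if i = 1 then f 0 - a
    else if i \<le> half p + 1 then f (int (i - 1)) + f (- int (i - 1))
    else if i = half p + 2 then b + c else b - c)"

lemma tqft_index_cases:
  assumes "i < dimH p"
  obtains "i = 0" | "i = 1" | k where "i = k + 1" "k \<in> {1..half p}" | "i = half p + 2" | "i = half p + 3"
proof -
  have "i = 0 \<or> i = 1 \<or> i - 1 \<in> {1..half p} \<or> i = half p + 2 \<or> i = half p + 3"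
    using assms by (auto simp: dimH_def)
  moreover have "i = (i - 1) + 1" if "i - 1 \<in> {1..half p}"
    using that unfolding atLeastAtMost_iff by linarith
  ultimately show ?thesis using that(1,2,4,5) that(3)[of "i - 1"] by (elim disjE) simp_all
qed

lemma sum_tqft_indices:
  fixes g :: "nat \<Rightarrow> 'a :: comm_monoid_add"
  shows "sum g {0..<n + 4} = g 0 + g 1 + (\<Sum>j\<in>{1..n}. g (j + 1)) + g (n + 2) + g (n + 3)"
  by (induction n) (simp_all add: eval_nat_numeral ac_simps)

lemma mat_of_cols_mult_tqft_basis:
  fixes x0 x1 x2 x3 :: "complex vec"
  assumes v: "v \<in> carrier_vec (dimH p)" and i: "i < dimH p"
  shows "(mat_of_cols (dimH p) ([x0, x1] @ map y [1..<half p + 1] @ [x2, x3]) *\<^sub>v v) $ i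
    = x0 $ i * v $ 0 + x1 $ i * v $ 1 + (\<Sum>j\<in>{1..half p}. y j $ i * v $ (j + 1))
      + x2 $ i * v $ (half p + 2) + x3 $ i * v $ (half p + 3)"
proof -
  define cs where "cs = [x0, x1] @ map y [1..<half p + 1] @ [x2, x3]"
  let ?g = "\<lambda>j. cs ! j $ i * v $ j"
  have len: "length cs = dimH p" by (simp add: cs_def dimH_def del: upt_Suc)
  have nth: "cs ! 0 = x0" "cs ! 1 = x1" "cs ! (half p + 2) = x2" "cs ! (half p + 3) = x3"
    by (simp_all add: cs_def nth_append del: upt_Suc)
  have nth_y: "cs ! (j + 1) = y j" if "j \<in> {1..half p}" for j
    using that by (cases j) (simp_all add: cs_def nth_append del: upt_Suc)
  have "(mat_of_cols (dimH p) cs *\<^sub>v v) $ i = sum ?g {0..<dimH p}"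
    using v i len by (simp add: scalar_prod_def mat_of_cols_index)
  also have "\<dots> = ?g 0 + ?g 1 + (\<Sum>j\<in>{1..half p}. ?g (j + 1)) + ?g (half p + 2) + ?g (half p + 3)"
    unfolding dimH_def by (rule sum_tqft_indices)
  also have "(\<Sum>j\<in>{1..half p}. ?g (j + 1)) = (\<Sum>j\<in>{1..half p}. y j $ i * v $ (j + 1))"
    by (intro sum.cong refl) (simp only: nth_y)
  finally show ?thesis unfolding cs_def[symmetric] nth .
qed

lemma sum_Y_index:
  assumes "i < dimH p"
  shows "sum_Y p c $ i = (if i \<in> {2..half p + 1} then c (i - 1) else 0)"
proof -
  have "sum_Y p c $ i = (\<Sum>k\<in>{1..half p}. (c k \<cdot>\<^sub>v b_Y p k) $ i)"
    unfolding sum_Y_def by (rule index_finsum_vec) (use assms in \<open>auto simp: b_Y_def\<close>)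
  also have "\<dots> = (\<Sum>k\<in>{1..half p}. if k = i - 1 then (if i \<in> {2..half p + 1} then c k else 0) else 0)"
    using assms by (intro sum.cong refl) (auto simp: b_Y_def dimH_def)
  also have "\<dots> = (if i \<in> {2..half p + 1} then c (i - 1) else 0)"
    by (auto simp: sum.delta)
  finally show ?thesis .
qed

lemma sum_Y_carrier [simp]: "sum_Y p c \<in> carrier_vec (dimH p)"
  unfolding sum_Y_def by (rule finsum_vec_closed) (auto simp: b_Y_def)

lemma b_Y_index: "i < dimH p \<Longrightarrow> b_Y p j $ i = (if i = j + 1 then 1 else 0)"
  by (auto simp: b_Y_def unit_vec_def)

lemma basis_index:
  assumes "i < dimH p"
  shows "b_one p $ i = (if i = 0 then 1 else 0)" "b_Z p $ i = (if i = 1 then 1 else 0)"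
    "b_X p $ i = (if i = half p + 2 then 1 else 0)" "b_X' p $ i = (if i = half p + 3 then 1 else 0)"
  using assms by (auto simp: b_one_def b_Z_def b_X_def b_X'_def dimH_def)

lemma basis_dim [simp]:
  "dim_vec (b_one p) = dimH p" "dim_vec (b_Z p) = dimH p" "dim_vec (b_Y p j) = dimH p"
  "dim_vec (b_X p) = dimH p" "dim_vec (b_X' p) = dimH p" "dim_vec (sum_Y p c) = dimH p"
  using sum_Y_carrier[of p c] by (simp_all add: b_one_def b_Z_def b_Y_def b_X_def b_X'_def)

lemma tqft_vec_carrier: "tqft_vec p f a b c \<in> carrier_vec (dimH p)"
  by (simp add: tqft_vec_def)

lemma tqft_vec_index:
  "tqft_vec p f a b c $ 0 = f 0 + a"
  "tqft_vec p f a b c $ 1 = f 0 - a"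
  "j \<in> {1..half p} \<Longrightarrow> tqft_vec p f a b c $ (j + 1) = f (int j) + f (- int j)"
  "tqft_vec p f a b c $ (half p + 2) = b + c"
  "tqft_vec p f a b c $ (half p + 3) = b - c"
  by (auto simp: tqft_vec_def dimH_def)

text \<open>
  \<open>tau\<close> exchanges the lines of \<open>X + X'\<close> and \<open>X - X'\<close> because its eigenvalues on \<open>X\<close> and \<open>X'\<close>
  are opposite. On functions it is multiplication by \<open>\<theta>\<close>; that this descends to \<open>H\<close> uses that
  \<open>\<theta>\<close> is even.
\<close>

lemma rho_tau_tqft_vec:
  "rho_tau p *\<^sub>v tqft_vec p f a b c = tqft_vec p (\<lambda>j. theta p j * f j) a (psi p * c) (psi p * b)"
proof (rule eq_vecI)
  let ?v = "tqft_vec p f a b c" and ?v' = "tqft_vec p (\<lambda>j. theta p j * f j) a (psi p * c) (psi p * b)"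
  fix i assume "i < dim_vec ?v'"
  then have i: "i < dimH p" by (simp add: tqft_vec_def)
  have Y: "(\<Sum>j\<in>{1..half p}. (theta p (int j) \<cdot>\<^sub>v b_Y p j) $ i * ?v $ (j + 1))
      = (\<Sum>j\<in>{1..half p}. if i = j + 1 then theta p (int j) * ?v $ (j + 1) else 0)"
    by (intro sum.cong refl) (use i in \<open>simp add: b_Y_index\<close>)
  have entry: "(rho_tau p *\<^sub>v ?v) $ i = b_one p $ i * ?v $ 0 + b_Z p $ i * ?v $ 1
      + (\<Sum>j\<in>{1..half p}. if i = j + 1 then theta p (int j) * ?v $ (j + 1) else 0)
      + psi p * b_X p $ i * ?v $ (half p + 2) - psi p * b_X' p $ i * ?v $ (half p + 3)"
    unfolding rho_tau_def mat_of_cols_mult_tqft_basis[OF tqft_vec_carrier i] Y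
    using i by simp
  from i show "(rho_tau p *\<^sub>v ?v) $ i = ?v' $ i"
  proof (cases rule: tqft_index_cases)
    case (3 k)
    then show ?thesis
      unfolding entry basis_index[OF i] by (simp add: tqft_vec_index(3) distrib_left del: One_nat_def)
  qed (unfold entry basis_index[OF i], simp_all add: tqft_vec_index[simplified] algebra_simps)
qed (simp add: rho_tau_def tqft_vec_def dimH_def)

text \<open>
  \<open>sigma\<close> is the Fourier transform on functions: the coefficients \<open>A\<^sub>k\<^sub>j\<close> collect the terms of
  \<open>j\<close> and \<open>-j\<close>. On the three-dimensional part it exchanges \<open>1 - Z\<close> with \<open>X + X'\<close> and fixes
  \<open>X - X'\<close>.
\<close>

lemma rho_sigma_tqft_vec:
  assumes p: "odd p" and f: "periodic p f"
  shows "rho_sigma p *\<^sub>v tqft_vec p f a b c = tqft_vec p (dft p f) b a c"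
proof (rule eq_vecI)
  let ?v = "tqft_vec p f a b c" and ?v' = "tqft_vec p (dft p f) b a c"
  fix i assume "i < dim_vec ?v'"
  then have i: "i < dimH p" by (simp add: tqft_vec_def)
  have p0: "p > 0" using p by (cases p) auto
  have dft_eq: "dft p f k = rsqrt p * (f 0 + (\<Sum>j\<in>{1..half p}.
      unity_char p (int j * k) * f (int j) + unity_char p (- (int j * k)) * f (- int j)))" for k
  proof -
    have "periodic p (\<lambda>j. unity_char p (j * k) * f j)"
      using unity_char_cong[OF p0] periodicD[OF f] unfolding periodic_def
      by (metis cong_mult cong_refl)
    from sum_periodic_symmetric[OF p this] show ?thesis by (simp add: dft_def)
  qed
  have dft_sym: "dft p f (int k) + dft p f (- int k)
      = 2 * rsqrt p * f 0 + (\<Sum>j\<in>{1..half p}. coeffA p k j * (f (int j) + f (- int j)))" for k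
    unfolding dft_eq coeffA_def unity_char_def[symmetric]
    by (simp add: distrib_left sum_distrib_left sum.distrib algebra_simps)
  have Y: "(\<Sum>j\<in>{1..half p}. (rsqrt p \<cdot>\<^sub>v (b_one p + b_Z p) + sum_Y p (\<lambda>k. coeffA p k j)) $ i * ?v $ (j + 1))
      = (\<Sum>j\<in>{1..half p}. (if i \<le> 1 then rsqrt p else if i \<le> half p + 1 then coeffA p (i - 1) j else 0)
          * (f (int j) + f (- int j)))"
    by (intro sum.cong refl) (use i tqft_vec_index(3) in \<open>auto simp: basis_index sum_Y_index\<close>)
  have entry: "(rho_sigma p *\<^sub>v ?v) $ i =
        (rsqrt p / 2 * (b_one p $ i + b_Z p $ i) + rsqrt p * sum_Y p (\<lambda>k. 1) $ i + 1 / 2 * (b_X p $ i + b_X' p $ i)) * (f 0 + a)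
      + (rsqrt p / 2 * (b_one p $ i + b_Z p $ i) + rsqrt p * sum_Y p (\<lambda>k. 1) $ i - 1 / 2 * (b_X p $ i + b_X' p $ i)) * (f 0 - a)
      + (\<Sum>j\<in>{1..half p}. (if i \<le> 1 then rsqrt p else if i \<le> half p + 1 then coeffA p (i - 1) j else 0)
          * (f (int j) + f (- int j)))
      + (1 / 2 * (b_one p $ i - b_Z p $ i) + 1 / 2 * (b_X p $ i - b_X' p $ i)) * (b + c)
      + (1 / 2 * (b_one p $ i - b_Z p $ i) - 1 / 2 * (b_X p $ i - b_X' p $ i)) * (b - c)"
    unfolding rho_sigma_def mat_of_cols_mult_tqft_basis[OF tqft_vec_carrier i] Y tqft_vec_index
    using i by simp
  from i show "(rho_sigma p *\<^sub>v ?v) $ i = ?v' $ i"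
  proof (cases rule: tqft_index_cases)
    case (3 k)
    then show ?thesis
      unfolding entry basis_index[OF i] sum_Y_index[OF i] using dft_sym[of k] tqft_vec_index(3)[of k]
      by (simp add: algebra_simps)
  qed (unfold entry basis_index[OF i] sum_Y_index[OF i],
      simp_all add: tqft_vec_index[simplified] dft_eq[of 0] sum_distrib_left field_simps)
qed (simp add: rho_sigma_def tqft_vec_def dimH_def)

section \<open>A finite invariant set and the finiteness of the image\<close>

text \<open>
  In the three-dimensional part all triples of scalars are admitted,
  since both generators permute the three coordinates up to roots of unity.
\<close>

definition tqft_stable_set :: "nat \<Rightarrow> complex vec set" where
  "tqft_stable_set p = {tqft_vec p f a b c | f a b c. f \<in> chirp_family p
     \<and> a \<in> root_scalars p \<and> b \<in> root_scalars p \<and> c \<in> root_scalars p}"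

lemma tqft_stable_set_carrier: "tqft_stable_set p \<subseteq> carrier_vec (dimH p)"
  by (auto simp: tqft_stable_set_def tqft_vec_def)

lemma finite_tqft_stable_set:
  assumes p0: "p > 0" shows "finite (tqft_stable_set p)"
proof -
  \<comment> \<open>\<open>V\<close> contains the values of the functions and the scalars, and \<open>S\<close> the coordinates of the vectors.\<close>
  define V where "V = root_scalars p \<union> (\<lambda>w. rsqrt p * w) ` root_scalars p"
  define S where "S = (\<lambda>(x, y). x + y) ` (V \<times> V) \<union> (\<lambda>(x, y). x - y) ` (V \<times> V)"
  have S: "x + y \<in> S" "x - y \<in> S" if "x \<in> V" "y \<in> V" for x y
    using that by (auto simp: S_def)
  have fam: "f j \<in> V" if "f \<in> chirp_family p" for f j
  proof -
    from that show ?thesis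
    proof (cases rule: chirp_family_cases)
      case (1 w m)
      then show ?thesis using root_scalars_mem(1) by (simp add: V_def delta_def)
    next
      case (2 w a b)
      have "f j = rsqrt p * (unity_char p (a * j\<^sup>2 + b * j) * w)" by (simp add: 2(1) chirp_def)
      then show ?thesis using root_scalars_mult[OF unity_char_power_8p[OF p0] 2(2)] unfolding V_def by blast
    qed
  qed
  have "root_scalars p \<subseteq> V" by (simp add: V_def)
  then have "tqft_vec p f a b c $ i \<in> S" if "i < dimH p" "f \<in> chirp_family p"
    "a \<in> root_scalars p" "b \<in> root_scalars p" "c \<in> root_scalars p" for f a b c i
    using that fam S by (simp add: tqft_vec_def subset_iff)
  then have "tqft_stable_set p \<subseteq> {v \<in> carrier_vec (dimH p). \<forall>i<dimH p. v $ i \<in> S}"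
    by (auto simp: tqft_stable_set_def tqft_vec_carrier)
  moreover have "finite S" using finite_root_scalars[OF p0] by (simp add: S_def V_def)
  ultimately show ?thesis using finite_vecs finite_subset by blast
qed

text \<open>
  The unit vectors of \<open>1\<close> and \<open>Z\<close> are half the sum and half the difference of \<open>1 + Z\<close> and
  \<open>1 - Z\<close>, and similarly for \<open>X\<close> and \<open>X'\<close>.
\<close>

lemma unit_vec_in_tqft_stable_set:
  assumes p: "odd p" and i: "i < dimH p"
  shows "unit_vec (dimH p) i \<in> tqft_stable_set p"
proof -
  have p_eq: "p = 2 * half p + 1" using p by (auto simp: half_def elim!: oddE)
  have orbit: "tqft_vec p (\<lambda>j. w * delta p m j) a b c \<in> tqft_stable_set p"
    if "w \<in> root_scalars p" "a \<in> root_scalars p" "b \<in> root_scalars p" "c \<in> root_scalars p" for w m a b c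
    using that chirp_familyI(1) unfolding tqft_stable_set_def by blast
  have small: "[x = 0] (mod int p) \<longleftrightarrow> x = 0" if "\<bar>x\<bar> < int p" for x
    using that zdvd_not_zless[of "\<bar>x\<bar>" "int p"] by (auto simp: cong_0_iff)
  have delta0: "delta p 0 x = (if x = 0 then 1 else 0)" if "\<bar>x\<bar> \<le> int (half p)" for x
    using that small[of x] p_eq by (simp add: delta_def)
  from i show ?thesis
  proof (cases rule: tqft_index_cases)
    case 1
    have "unit_vec (dimH p) i = tqft_vec p (\<lambda>j. 1/2 * delta p 0 j) (1/2) 0 0"
      by (rule eq_vecI) (auto simp: 1 tqft_vec_def dimH_def delta0)
    then show ?thesis by (simp only: orbit root_scalars_mem)
  next
    case 2
    have "unit_vec (dimH p) i = tqft_vec p (\<lambda>j. 1/2 * delta p 0 j) (- 1/2) 0 0"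
      by (rule eq_vecI) (auto simp: 2 tqft_vec_def dimH_def delta0)
    then show ?thesis by (simp only: orbit root_scalars_mem)
  next
    case (3 k)
    let ?m = "int k"
    have d: "delta p ?m x = (if x = ?m then 1 else 0)" if "\<bar>x\<bar> \<le> int (half p)" for x
    proof -
      have "[x = ?m] (mod int p) \<longleftrightarrow> [x - ?m = 0] (mod int p)" by (simp add: cong_iff_dvd_diff)
      also have "\<dots> \<longleftrightarrow> x = ?m" using that 3 p_eq by (subst small) auto
      finally show ?thesis by (simp add: delta_def)
    qed
    have "unit_vec (dimH p) i = tqft_vec p (\<lambda>j. 1 * delta p ?m j) 0 0 0"
      using 3 by (intro eq_vecI) (auto simp: tqft_vec_def dimH_def d)
    then show ?thesis by (simp only: orbit root_scalars_mem)
  next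
    case 4
    have "unit_vec (dimH p) i = tqft_vec p (\<lambda>j. 0 * delta p 0 j) 0 (1/2) (1/2)"
      by (rule eq_vecI) (auto simp: 4 tqft_vec_def dimH_def)
    then show ?thesis by (simp only: orbit root_scalars_mem)
  next
    case 5
    have "unit_vec (dimH p) i = tqft_vec p (\<lambda>j. 0 * delta p 0 j) 0 (1/2) (- 1/2)"
      by (rule eq_vecI) (auto simp: 5 tqft_vec_def dimH_def)
    then show ?thesis by (simp only: orbit root_scalars_mem)
  qed
qed

lemma psi_power: "psi p ^ (8 * p) = 1"
proof -
  have "psi p = cis (2 * pi * real (half p) / 8)"
    by (simp add: psi_def cis_conv_exp mult_ac)
  then have "psi p ^ 8 = cis (real 8 * (2 * pi * real (half p) / 8))" by (simp only: DeMoivre)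
  also have "real 8 * (2 * pi * real (half p) / 8) = 2 * pi * real (half p)" by simp
  also have "cis \<dots> = 1" by (rule cis_multiple_2pi) simp
  finally show ?thesis unfolding power_mult by simp
qed

theorem corollary4:
  fixes p :: nat and rho :: "int mat \<Rightarrow> complex mat set"
  assumes "prime p" and "odd p" and "p \<ge> 5"
    and "rho \<in> hom SL2Z (PGL (dimH p))"
    and "rho sigma = proj_class (dimH p) (rho_sigma p)"
    and "rho tau = proj_class (dimH p) (rho_tau p)"
  shows "finite (rho ` carrier SL2Z)"
proof -
  have p0: "p > 0" using assms(3) by simp
  let ?K = "{M \<in> carrier (GL (dimH p)). \<forall>v\<in>tqft_stable_set p. M *\<^sub>v v \<in> tqft_stable_set p}"
  \<comment> \<open>The two matrices are invertible because their classes are values of \<open>rho\<close>.\<close>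
  have GL: "M \<in> carrier (GL (dimH p))"
    if "M \<in> carrier_mat (dimH p) (dimH p)" "proj_class (dimH p) M = rho g" "g \<in> carrier SL2Z" for M g
    using that(1) by (rule in_GL_if_proj_class_in_PGL) (use hom_in_carrier[OF assms(4) that(3)] that(2) in simp)
  have sigma_GL: "rho_sigma p \<in> carrier (GL (dimH p))"
    by (rule GL[OF _ assms(5)[symmetric] sigma_in_SL2Z]) (simp add: rho_sigma_def dimH_def carrier_matI)
  have tau_GL: "rho_tau p \<in> carrier (GL (dimH p))"
    by (rule GL[OF _ assms(6)[symmetric] tau_in_SL2Z]) (simp add: rho_tau_def dimH_def carrier_matI)
  have "rho_sigma p *\<^sub>v v \<in> tqft_stable_set p" "rho_tau p *\<^sub>v v \<in> tqft_stable_set p" if v: "v \<in> tqft_stable_set p" for v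
  proof -
    obtain f a b c where v_eq: "v = tqft_vec p f a b c" and f: "f \<in> chirp_family p"
      and abc: "a \<in> root_scalars p" "b \<in> root_scalars p" "c \<in> root_scalars p"
      using v unfolding tqft_stable_set_def by blast
    show "rho_sigma p *\<^sub>v v \<in> tqft_stable_set p"
      unfolding v_eq rho_sigma_tqft_vec[OF assms(2) periodic_chirp_family[OF p0 f]] tqft_stable_set_def
      using dft_chirp_family[OF assms(1,2) f] abc by blast
    show "rho_tau p *\<^sub>v v \<in> tqft_stable_set p"
      unfolding v_eq rho_tau_tqft_vec tqft_stable_set_def
      using theta_chirp_family[OF p0 f] root_scalars_mult[OF psi_power] abc by blast
  qed
  then have "rho_sigma p \<in> ?K" "rho_tau p \<in> ?K" using sigma_GL tau_GL by simp_all
  moreover have "subgroup ?K (GL (dimH p))" "finite ?K"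
    using finite_stabilizer_subgroup[OF finite_tqft_stable_set[OF p0] tqft_stable_set_carrier]
      unit_vec_in_tqft_stable_set[OF assms(2)] by blast+
  ultimately show ?thesis
    using finite_image_if_generators_in_finite_subgroup[OF assms(4)] assms(5,6) by blast
qed

end
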